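(* If $P_0$ or $P_1$ (or both) contain a constant term, then the implicit polygon $N(\phi)$ is the triangle with vertices $(0,0),(a_{1m},0),(0,a_{0n})$. Otherwise, $P_0,P_1$ contain no constant terms, and $N(\phi)$ is the quadrilateral with vertices $(a_{11},0),(a_{1m},0),(0,a_{0n}),(0,a_{01})$.
   Context: Consider a polynomial parameterization $x=P_0(t)$, $y=P_1(t)$ with $P_0,P_1\in\mathbb{C}[t]$ having fixed supports and generic coefficients (the result holds for all coefficient vectors in some open dense subset), the parameterization having degree $1$. Let $f_0=x-P_0(t)$, $f_1=y-P_1(t)\in(\mathbb{C}[x,y])[t]$, with supports (in $t$) $A_0=\{a_{00}<a_{01}<\dots<a_{0n}\}$ and $A_1=\{a_{10}<a_{11}<\dots<a_{1m}\}$; here always $a_{00}=a_{10}=0$ (because of the terms $x$ and $y$). The implicit equation $\phi\in\mathbb{C}[x,y]$ is the generator of the ideal of polynomials vanishing on the parameterization, and $N(\phi)$ is its Newton polygon (convex hull of the exponent vectors occurring in $\phi$). Listed vertices may coincide in degenerate cases (e.g. if $a_{11}=a_{1m}$). *)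

theory Defs
  imports "HOL-Analysis.Analysis" "HOL-Computational_Algebra.Polynomial"
begin

text \<open>
  The ring \<open>\<complex>[x,y]\<close> is represented by \<^typ>\<open>complex poly poly\<close>, the outer variable being \<open>y\<close>:
  the coefficient of \<open>x\<^sup>i y\<^sup>j\<close> in \<open>q\<close> is \<open>coeff (coeff q j) i\<close>.
\<close>

definition eval_xy :: "complex poly poly \<Rightarrow> complex \<Rightarrow> complex \<Rightarrow> complex" where
  "eval_xy q x y = poly (poly q [:y:]) x"

definition var_x :: "complex poly poly" where
  "var_x = [:[:0, 1:]:]"

definition var_y :: "complex poly poly" where
  "var_y = [:0, 1:]"

definition newton_polygon :: "complex poly poly \<Rightarrow> (real \<times> real) set" where
  "newton_polygon q = convex hull {(real i, real j) |i j. coeff (coeff q j) i \<noteq> 0}"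

definition poly_support :: "'a::zero poly \<Rightarrow> nat set" where
  "poly_support p = {k. coeff p k \<noteq> 0}"

definition sparse_poly :: "nat set \<Rightarrow> (nat \<Rightarrow> complex) \<Rightarrow> complex poly" where
  "sparse_poly S c = (\<Sum>k\<in>S. monom (c k) k)"

text \<open>
  Pairs of polynomials with supports exactly \<open>S0\<close> and \<open>S1\<close> are parameterized by
  \<open>(\<complex> - {0})\<close>-valued families on \<open>S0\<close> and \<open>S1\<close>, with the usual (Euclidean) topology.
\<close>

definition coeff_space ::
    "nat set \<Rightarrow> nat set \<Rightarrow> ((nat \<Rightarrow> complex) \<times> (nat \<Rightarrow> complex)) topology" where
  "coeff_space S0 S1 =
     prod_topology (product_topology (\<lambda>_. top_of_set (- {0})) S0)
                   (product_topology (\<lambda>_. top_of_set (- {0})) S1)"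

text \<open>
  The degree of a parameterization is the number of parameter values over a generic point
  of the curve, a generic point being the image of all but finitely many parameters.
\<close>

definition has_param_degree :: "complex poly \<Rightarrow> complex poly \<Rightarrow> nat \<Rightarrow> bool" where
  "has_param_degree P0 P1 d \<longleftrightarrow>
     finite {t. card {s. poly P0 s = poly P0 t \<and> poly P1 s = poly P1 t} \<noteq> d}"

definition vanishing_ideal :: "complex poly \<Rightarrow> complex poly \<Rightarrow> complex poly poly set" where
  "vanishing_ideal P0 P1 = {q. \<forall>t. eval_xy q (poly P0 t) (poly P1 t) = 0}"

text \<open>The generator is unique up to a nonzero scalar, so this is a predicate.\<close>

definition implicit_equation :: "complex poly \<Rightarrow> complex poly \<Rightarrow> complex poly poly \<Rightarrow> bool" where
  "implicit_equation P0 P1 \<phi> \<longleftrightarrow> vanishing_ideal P0 P1 = {q. \<phi> dvd q}"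

text \<open>
  The polynomial \<open>v - P(t)\<close> in \<open>(\<complex>[x,y])[t]\<close>, where \<open>v\<close> is \<open>x\<close> or \<open>y\<close>. Its support in \<open>t\<close>
  contains 0 whether or not \<open>P\<close> has a constant term.
\<close>

definition graph_poly :: "complex poly poly \<Rightarrow> complex poly \<Rightarrow> complex poly poly poly" where
  "graph_poly v P = [:v:] - map_poly (\<lambda>c. [:[:c:]:]) P"

lemma poly_support_sparse_poly:
  assumes "finite S" "\<And>k. k \<in> S \<Longrightarrow> c k \<noteq> 0"
  shows "poly_support (sparse_poly S c) = S"
proof -
  have "coeff (sparse_poly S c) k = (if k \<in> S then c k else 0)" for k
    using assms(1) by (simp add: sparse_poly_def coeff_sum)
  with assms(2) show ?thesis by (auto simp: poly_support_def)
qed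

lemma poly_support_graph_poly:
  assumes "v = var_x \<or> v = var_y"
  shows "poly_support (graph_poly v P) = insert 0 (poly_support P)"
proof -
  have "coeff (graph_poly v P) k \<noteq> 0 \<longleftrightarrow> k = 0 \<or> coeff P k \<noteq> 0" for k
    using assms
    by (cases k) (auto simp: graph_poly_def var_x_def var_y_def coeff_map_poly)
  then show ?thesis by (auto simp: poly_support_def)
qed

end

theory Submission
  imports Defs "HOL-Complex_Analysis.Conformal_Mappings"
    "HOL-Computational_Algebra.Fundamental_Theorem_Algebra"
begin

text \<open>
  Write \<open>P = P0\<close> and \<open>Q = P1\<close>. The function \<open>F(x, y) = \<Prod> (Q(\<tau>) - y)\<close>, the product over the roots
  \<open>\<tau>\<close> of \<open>P = x\<close>, is up to a constant also \<open>\<Prod> (P(s) - x)\<close> over the roots \<open>s\<close> of \<open>Q = y\<close>. Being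
  polynomial in each variable with bounded degree, it is a polynomial in both, the eliminant \<open>R\<close>
  (\<open>fibre_poly_swap\<close>, \<open>exists_eliminant\<close>). It vanishes on the curve, hence is a multiple of the
  implicit equation \<open>\<phi>\<close>; since the parameterization has degree \<open>1\<close>, \<open>\<phi>\<close> has at least \<open>deg P\<close> roots
  over a generic \<open>x\<close>, and \<open>R\<close> is a constant multiple of \<open>\<phi>\<close> (\<open>implicit_equation_eliminant\<close>). So
  it suffices to find the Newton polygon of \<open>R\<close>, from the product formula.

  Vertices: on the axes, \<open>R(0, y)\<close> and \<open>R(x, 0)\<close> are explicit products of linear factors. Their degrees
  are \<open>deg P\<close> and \<open>deg Q\<close>, and their orders at \<open>0\<close> count the common zeros of \<open>P\<close> and \<open>Q\<close>. Generically
  there is no common zero \<open>t \<noteq> 0\<close>. Then these orders are \<open>0\<close> if there is a constant term, and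
  otherwise the orders of \<open>P\<close> and \<open>Q\<close> at \<open>0\<close>.

  Edges: that no monomial lies beyond the edges is a statement about the size of
  \<open>R(w\<^sup>a x, w\<^sup>b)\<close>, namely that it is \<open>O(w\<^sup>a\<^sup>b)\<close>, for \<open>w \<rightarrow> \<infinity>\<close> with \<open>a = deg P\<close>, \<open>b = deg Q\<close>, and for
  \<open>w \<rightarrow> 0\<close> with \<open>a\<close>, \<open>b\<close> the orders at \<open>0\<close>. Each factor of the product is \<open>O(max(\<bar>\<tau>\<bar>, w)\<^sup>b)\<close>, and the
  product of all \<open>max(\<bar>\<tau>\<bar>, w)\<close> is bounded, up to the leading coefficient, by the maximum of
  \<open>P - w\<^sup>a x\<close> on the circle of radius \<open>w\<close> (\<open>lead_coeff_prod_max_roots_le\<close>), which is \<open>O(w\<^sup>a)\<close>.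

  Genericity: the set of coefficients without a common zero \<open>t \<noteq> 0\<close> is open, because its complement
  is a projection along the compact space of homogeneous parameters (\<open>openin_no_common_torus_zero\<close>),
  and dense, because one coefficient can be perturbed (\<open>dense_no_common_torus_zero\<close>).
\<close>

section \<open>Products over fibres and the eliminant\<close>

lemma prod_mset_const_mult:
  fixes f :: "'a \<Rightarrow> 'b :: comm_monoid_mult"
  shows "(\<Prod>x\<in>#M. c * f x) = c ^ size M * (\<Prod>x\<in>#M. f x)"
  by (induction M) (auto simp: mult_ac)

lemma prod_mset_power:
  fixes f :: "'a \<Rightarrow> 'b :: comm_monoid_mult"
  shows "(\<Prod>x\<in>#M. f x ^ n) = (\<Prod>x\<in>#M. f x) ^ n"
  by (induction M) (auto simp: power_mult_distrib)

lemma prod_mset_mono_nonneg: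
  fixes f g :: "'a \<Rightarrow> real"
  assumes "\<And>x. x \<in># M \<Longrightarrow> 0 \<le> f x \<and> f x \<le> g x"
  shows "0 \<le> (\<Prod>x\<in>#M. f x) \<and> (\<Prod>x\<in>#M. f x) \<le> (\<Prod>x\<in>#M. g x)"
  using assms by (induction M) (auto intro!: mult_mono intro: order.trans)

lemma norm_prod_mset: "norm (\<Prod>x\<in>#M. f x :: complex) = (\<Prod>x\<in>#M. norm (f x))"
  by (induction M) (auto simp: norm_mult)

text \<open>
  Up to a nonzero constant, the resultant of \<open>P - x\<close> and \<open>Q - y\<close> with respect to the parameter, for
  fixed \<open>x\<close> and as a polynomial in \<open>y\<close>.
\<close>

definition fibre_poly :: "complex poly \<Rightarrow> complex poly \<Rightarrow> complex \<Rightarrow> complex poly" where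
  "fibre_poly P Q x = (\<Prod>\<tau>\<in>#proots (P - [:x:]). [:poly Q \<tau>, -1:])"

lemma poly_fibre_poly:
  "poly (fibre_poly P Q x) y = (\<Prod>\<tau>\<in>#proots (P - [:x:]). poly Q \<tau> - y)"
  by (simp add: fibre_poly_def poly_prod_mset)

lemma degree_diff_const:
  fixes P :: "complex poly"
  shows "degree (P - [:x:]) = degree P"
proof (cases "degree P = 0")
  case True
  then obtain a where "P = [:a:]" by (metis degree_eq_zeroE)
  then show ?thesis by simp
next
  case False
  then have "degree (P + [:-x:]) = degree P" by (intro degree_add_eq_left) auto
  then show ?thesis unfolding diff_conv_add_uminus by simp
qed

lemma lead_coeff_diff_const:
  fixes P :: "complex poly"
  assumes "degree P > 0"
  shows "lead_coeff (P - [:x:]) = lead_coeff P"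
  unfolding degree_diff_const using assms by (cases "degree P") auto

lemma diff_const_nonzero:
  fixes P :: "complex poly"
  assumes "degree P > 0"
  shows "P - [:x:] \<noteq> 0"
  using assms degree_diff_const[of P x] by auto

lemma in_proots_diff_const:
  fixes P :: "complex poly"
  assumes "degree P > 0"
  shows "\<tau> \<in># proots (P - [:x:]) \<longleftrightarrow> poly P \<tau> = x"
  using set_count_proots[OF diff_const_nonzero[OF assms]] by auto

lemma size_proots_diff_const:
  fixes P :: "complex poly"
  shows "size (proots (P - [:x:])) = degree P"
  using size_proots_complex degree_diff_const by metis

lemma degree_prod_mset_linear:
  fixes f :: "'a \<Rightarrow> complex"
  shows "degree (\<Prod>s\<in>#M. [:f s, -1:]) = size M \<and> (\<Prod>s\<in>#M. [:f s, -1:]) \<noteq> 0"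
  by (induction M) (auto simp: degree_mult_eq simp del: mult_pCons_left)

lemma degree_fibre_poly: "degree (fibre_poly P Q x) = degree P"
  unfolding fibre_poly_def using degree_prod_mset_linear size_proots_diff_const by metis

lemma fibre_poly_nonzero: "fibre_poly P Q x \<noteq> 0"
  unfolding fibre_poly_def using degree_prod_mset_linear by blast

lemma poly_eq_lead_coeff_prod_roots:
  fixes P :: "complex poly"
  assumes "degree P > 0"
  shows "poly P t - x = lead_coeff P * (\<Prod>\<tau>\<in>#proots (P - [:x:]). t - \<tau>)"
proof -
  have "poly (P - [:x:]) t = poly (smult (lead_coeff (P - [:x:])) (\<Prod>\<tau>\<in>#proots (P - [:x:]). [:-\<tau>, 1:])) t"
    by (simp only: complex_poly_decompose_multiset)
  then show ?thesis using lead_coeff_diff_const[OF assms] by (simp add: poly_prod_mset)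
qed

lemma prod_mset_swap_minus:
  "(\<Prod>x\<in>#M. \<Prod>y\<in>#N. (x::complex) - y) = (-1) ^ (size M * size N) * (\<Prod>y\<in>#N. \<Prod>x\<in>#M. y - x)"
proof (induction M)
  case (add a M)
  have 1: "(\<Prod>y\<in>#N. a - y) = (-1) ^ size N * (\<Prod>y\<in>#N. y - a)"
    using prod_mset_const_mult[of "-1" "\<lambda>y. y - a" N] by simp
  have 2: "(\<Prod>y\<in>#N. \<Prod>x\<in>#add_mset a M. y - x) = (\<Prod>y\<in>#N. y - a) * (\<Prod>y\<in>#N. \<Prod>x\<in>#M. y - x)"
    by (simp add: prod_mset.distrib)
  show ?case unfolding 2 using add 1 by (simp add: power_add algebra_simps)
qed simp

text \<open>
  Splitting both \<open>P - x\<close> and \<open>Q - y\<close> into linear factors turns either side into the double product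
  of all differences of a root \<open>\<tau>\<close> of \<open>P - x\<close> and a root \<open>s\<close> of \<open>Q - y\<close>. This is what shows that
  the fibre products depend polynomially on \<open>x\<close> too.
\<close>

lemma fibre_poly_swap:
  assumes "degree P > 0" "degree Q > 0"
  shows "lead_coeff P ^ degree Q * poly (fibre_poly P Q x) y =
     (-1) ^ (degree P * degree Q) * lead_coeff Q ^ degree P * poly (fibre_poly Q P y) x"
  unfolding poly_fibre_poly poly_eq_lead_coeff_prod_roots[OF assms(1)]
    poly_eq_lead_coeff_prod_roots[OF assms(2)] prod_mset_const_mult size_proots_diff_const
  by (subst prod_mset_swap_minus) (simp add: size_proots_diff_const)

text \<open>
  Interpolation, one node at a time: dividing \<open>A x\<close> by \<open>y - y0\<close> lowers the degree and leaves the
  remainder \<open>poly (A x) y0\<close>, which is polynomial in \<open>x\<close>. The quotient is known to be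
  polynomial in \<open>x\<close> only at nodes other than \<open>y0\<close>, so the induction is over an arbitrary infinite
  set of nodes.
\<close>

lemma separately_polynomial_imp_polynomial:
  fixes A :: "complex \<Rightarrow> complex poly" and Y :: "complex set"
  assumes "\<And>x. degree (A x) \<le> d" and "infinite Y"
    and "\<And>y. y \<in> Y \<Longrightarrow> \<exists>B. \<forall>x. poly (A x) y = poly B x"
  shows "\<exists>R :: complex poly poly. degree R \<le> d \<and> (\<forall>x y. eval_xy R x y = poly (A x) y)"
  using assms
proof (induction d arbitrary: A Y)
  case 0
  then obtain y0 where "y0 \<in> Y" by (metis finite.emptyI equals0I)
  then obtain B where B: "\<And>x. poly (A x) y0 = poly B x" using 0 by blast
  have "poly (A x) y = poly B x" for x y
    using B[of x] "0"(1)[of x] by (auto elim!: degree_eq_zeroE)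
  then show ?case by (intro exI[of _ "[:B:]"]) (auto simp: eval_xy_def)
next
  case (Suc d)
  then obtain y0 where y0: "y0 \<in> Y" by (metis finite.emptyI equals0I)
  then obtain B0 where B0: "\<And>x. poly (A x) y0 = poly B0 x" using Suc by blast
  let ?A = "\<lambda>x. synthetic_div (A x) y0"
  have A: "poly (A x) y = (y - y0) * poly (?A x) y + poly B0 x" for x y
    using arg_cong[OF synthetic_div_correct'[of y0 "A x"], of "\<lambda>p. poly p y"] B0[of x]
    by (simp add: left_diff_distrib)
  have "\<exists>R :: complex poly poly. degree R \<le> d \<and> (\<forall>x y. eval_xy R x y = poly (?A x) y)"
  proof (rule Suc.IH)
    show "degree (?A x) \<le> d" for x using Suc.prems(1)[of x] by (simp add: degree_synthetic_div)
    show "infinite (Y - {y0})" using Suc.prems(2) by simp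
    show "\<exists>B. \<forall>x. poly (?A x) y = poly B x" if y: "y \<in> Y - {y0}" for y
    proof -
      from y obtain B where B: "\<And>x. poly (A x) y = poly B x" using Suc.prems(3)[of y] by blast
      have "poly (?A x) y = poly (smult (1 / (y - y0)) (B - B0)) x" for x
        using A[of x y] B[of x] y by (auto simp: field_simps)
      then show ?thesis by blast
    qed
  qed
  then obtain R where R: "degree R \<le> d" "\<And>x y. eval_xy R x y = poly (?A x) y" by blast
  show ?case
  proof (intro exI conjI allI)
    show "degree ([:-[:y0:], 1:] * R + [:B0:]) \<le> Suc d"
      by (intro degree_add_le order.trans[OF degree_mult_le]) (use R in auto)
    show "eval_xy ([:-[:y0:], 1:] * R + [:B0:]) x y = poly (A x) y" for x y
      using A[of x y] R(2)[of x y] by (simp add: eval_xy_def algebra_simps)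
  qed
qed

lemma exists_eliminant:
  assumes "degree P > 0" "degree Q > 0"
  shows "\<exists>R. degree R \<le> degree P \<and> (\<forall>x y. eval_xy R x y = poly (fibre_poly P Q x) y)"
proof (rule separately_polynomial_imp_polynomial[OF _ infinite_UNIV_char_0])
  show "degree (fibre_poly P Q x) \<le> degree P" for x by (simp add: degree_fibre_poly)
  fix y
  let ?c = "(-1) ^ (degree P * degree Q) * lead_coeff Q ^ degree P / lead_coeff P ^ degree Q"
  have "lead_coeff P \<noteq> 0" using assms by auto
  then have "poly (fibre_poly P Q x) y = poly (smult ?c (fibre_poly Q P y)) x" for x
    using fibre_poly_swap[OF assms, of x y] by (simp add: field_simps)
  then show "\<exists>B. \<forall>x. poly (fibre_poly P Q x) y = poly B x" by blast
qed

section \<open>Roots and the maximum principle\<close>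

text \<open>
  Landau's bound for the Mahler measure on a circle of radius \<open>w\<close>. Replacing each factor \<open>t - \<tau>\<close>
  with \<open>\<bar>\<tau>\<bar> < w\<close> by its Blaschke reflection changes nothing in modulus on the circle, while the
  value at \<open>0\<close> becomes the left-hand side; the maximum principle compares the two. The point of
  the bound is that it controls all roots at once, however they move with the coefficients of \<open>f\<close>.
\<close>

lemma lead_coeff_prod_max_roots_le:
  fixes f :: "complex poly"
  assumes w: "w > 0" and K: "\<And>t. norm t = w \<Longrightarrow> norm (poly f t) \<le> K"
  shows "norm (lead_coeff f) * (\<Prod>\<tau>\<in>#proots f. max (norm \<tau>) w) \<le> K"
proof -
  \<comment> \<open>the Blaschke-reflected linear factors\<close>
  define b where "b \<tau> t = (if norm \<tau> < w then (of_real w - cnj \<tau> * t / of_real w) else t - \<tau>)" for \<tau> t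
  define g where "g t = lead_coeff f * (\<Prod>\<tau>\<in>#proots f. b \<tau> t)" for t
  have b_norm: "norm (b \<tau> t) = norm (t - \<tau>)" if "norm t = w" for \<tau> t
  proof (cases "norm \<tau> < w")
    case True
    have tt: "t * cnj t = of_real w * of_real w"
      using that complex_norm_square[of t] by (simp add: power2_eq_square)
    have "of_real w * b \<tau> t = t * cnj (t - \<tau>)"
      using True w tt by (simp add: b_def field_simps)
    then have "w * norm (b \<tau> t) = norm t * norm (t - \<tau>)"
      by (metis complex_mod_cnj norm_mult norm_of_real abs_of_pos w)
    then show ?thesis using w that by simp
  qed (simp add: b_def)
  have f: "poly f t = lead_coeff f * (\<Prod>\<tau>\<in>#proots f. t - \<tau>)" for t
    by (subst complex_poly_decompose_multiset[of f, symmetric]) (simp add: poly_prod_mset)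
  have g_norm: "norm (g t) = norm (poly f t)" if "norm t = w" for t
    unfolding f g_def norm_mult norm_prod_mset using b_norm[OF that] by simp
  have hol: "(\<lambda>t. \<Prod>\<tau>\<in>#M. b \<tau> t) holomorphic_on UNIV" for M
  proof (induction M)
    case (add a M)
    have "b a holomorphic_on UNIV"
      unfolding b_def[abs_def] by (cases "norm a < w") (auto intro!: holomorphic_intros simp: w less_imp_neq[symmetric])
    with add show ?case by (auto intro!: holomorphic_intros)
  qed simp
  then have ghol: "g holomorphic_on UNIV" unfolding g_def[abs_def] by (auto intro!: holomorphic_intros)
  have "norm (g 0) \<le> K"
  proof (rule maximum_modulus_frontier[where S = "cball 0 w" and f = g and \<xi> = 0])
    show "g holomorphic_on interior (cball 0 w)" using ghol holomorphic_on_subset by blast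
    show "continuous_on (closure (cball 0 w)) g"
      using ghol holomorphic_on_imp_continuous_on continuous_on_subset by blast
    show "norm (g z) \<le> K" if "z \<in> frontier (cball 0 w)" for z
      using that g_norm[of z] K[of z] by (simp add: frontier_cball)
  qed (use w in auto)
  moreover have "norm (b \<tau> 0) = max (norm \<tau>) w" for \<tau> using w by (auto simp: b_def)
  ultimately show ?thesis by (simp add: g_def norm_mult norm_prod_mset)
qed

section \<open>Weighted degrees of the eliminant\<close>

lemma coeff_eq_0_if_small_near_0:
  fixes h :: "complex poly"
  assumes "\<And>w::real. 0 < w \<Longrightarrow> w \<le> 1 \<Longrightarrow> norm (poly h (of_real w)) \<le> C * w ^ N" and "k < N"
  shows "coeff h k = 0"
  using assms
proof (induction N arbitrary: h k)
  case (Suc N)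
  have "((\<lambda>w::real. poly h (of_real w)) \<longlongrightarrow> poly h (of_real 0)) (at_right 0)"
    by (intro isCont_tendsto_compose[OF poly_isCont] tendsto_intros)
  moreover have "((\<lambda>w::real. poly h (of_real w)) \<longlongrightarrow> 0) (at_right 0)"
  proof (rule tendsto_norm_zero_cancel, rule tendsto_sandwich[of "\<lambda>_. 0"])
    show "\<forall>\<^sub>F w in at_right (0::real). norm (poly h (of_real w)) \<le> C * w ^ Suc N"
      unfolding eventually_at_right_field using Suc.prems(1) by (intro exI[of _ 1]) auto
    have "((\<lambda>w::real. C * w ^ Suc N) \<longlongrightarrow> C * 0 ^ Suc N) (at_right 0)"
      by (intro tendsto_intros)
    then show "((\<lambda>w::real. C * w ^ Suc N) \<longlongrightarrow> 0) (at_right 0)" by simp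
  qed auto
  ultimately have "poly h 0 = 0"
    using tendsto_unique[OF trivial_limit_at_right_real] by fastforce
  then obtain g where h: "h = pCons 0 g"
    by (metis pCons_cases poly_pCons add.right_neutral mult_zero_left)
  have g: "norm (poly g (of_real w)) \<le> C * w ^ N" if "0 < w" "w \<le> 1" for w :: real
  proof -
    have "w * norm (poly g (of_real w)) \<le> w * (C * w ^ N)"
      using Suc.prems(1)[OF that] that by (simp add: h norm_mult algebra_simps)
    then show ?thesis using that by simp
  qed
  show ?case
  proof (cases k)
    case (Suc l)
    then show ?thesis using Suc.IH[of g l] g Suc.prems(2) by (simp add: h)
  qed (simp add: h)
qed simp

text \<open>
  The substitution \<open>u = 1 / w\<close> reduces growth at infinity to decay at \<open>0\<close> of the reflected
  polynomial.
\<close>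

lemma coeff_eq_0_if_small_growth:
  fixes h :: "complex poly"
  assumes h: "\<And>w::real. 1 \<le> w \<Longrightarrow> norm (poly h (of_real w)) \<le> C * w ^ N" and "N < k"
  shows "coeff h k = 0"
proof (rule ccontr)
  assume "coeff h k \<noteq> 0"
  then have D: "N < degree h" using \<open>N < k\<close> le_degree by fastforce
  have "norm (poly (reflect_poly h) (of_real u)) \<le> C * u ^ (degree h - N)" if "0 < u" "u \<le> 1" for u :: real
  proof -
    have "norm (poly (reflect_poly h) (of_real u)) = u ^ degree h * norm (poly h (of_real (inverse u)))"
      using that by (simp add: poly_reflect_poly_nz norm_mult norm_power)
    also have "\<dots> \<le> u ^ degree h * (C * inverse u ^ N)"
      using that by (intro mult_left_mono h) (auto simp: one_le_inverse_iff)
    also have "\<dots> = C * u ^ (degree h - N)"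
      using that D by (simp add: power_diff power_inverse field_simps)
    finally show ?thesis .
  qed
  then have "coeff (reflect_poly h) 0 = 0"
    using D by (intro coeff_eq_0_if_small_near_0[where N = "degree h - N" and C = C]) auto
  with D show False by simp
qed

lemma eval_xy_altdef:
  "eval_xy R x y = (\<Sum>j\<le>degree R. \<Sum>i\<le>degree (coeff R j). coeff (coeff R j) i * x ^ i * y ^ j)"
  unfolding eval_xy_def poly_altdef[of R]
  by (simp add: poly_sum poly_power) (simp add: poly_altdef sum_distrib_right)

text \<open>
  The polynomial \<open>w \<mapsto> R (w\<^sup>a x, w\<^sup>b)\<close>, whose coefficient at \<open>w\<^sup>k\<close> collects the monomials of
  \<open>R\<close> of weight \<open>k\<close> when \<open>x\<close> has weight \<open>a\<close> and \<open>y\<close> has weight \<open>b\<close>.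
\<close>

definition weighted_curve_poly :: "nat \<Rightarrow> nat \<Rightarrow> complex poly poly \<Rightarrow> complex \<Rightarrow> complex poly" where
  "weighted_curve_poly a b R x =
     (\<Sum>j\<le>degree R. \<Sum>i\<le>degree (coeff R j). monom (coeff (coeff R j) i * x ^ i) (a * i + b * j))"

lemma poly_weighted_curve_poly:
  "poly (weighted_curve_poly a b R x) w = eval_xy R (w ^ a * x) (w ^ b)"
  by (simp add: weighted_curve_poly_def eval_xy_altdef poly_sum poly_monom power_add
      power_mult_distrib mult_ac flip: power_mult)

text \<open>
  Setting \<open>y = 1\<close> loses nothing: for \<open>b > 0\<close>, two monomials of the same weight have
  different exponents of \<open>x\<close>.
\<close>

lemma coeff_weighted_curve_poly_zero:
  assumes "b > 0" and 0: "\<And>x. coeff (weighted_curve_poly a b R x) (a * i0 + b * j0) = 0"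
  shows "coeff (coeff R j0) i0 = 0"
proof -
  let ?k = "a * i0 + b * j0"
  define G where "G = (\<Sum>j\<le>degree R. \<Sum>i\<le>degree (coeff R j).
    if a * i + b * j = ?k then monom (coeff (coeff R j) i) i else 0)"
  have "poly G x = coeff (weighted_curve_poly a b R x) ?k" for x
    unfolding G_def weighted_curve_poly_def
    by (simp add: poly_sum coeff_sum if_distrib[of "\<lambda>p. poly p _"] poly_monom cong: if_cong)
  then have "G = 0" using 0 poly_all_0_iff_0[of G] by simp
  have inner: "(\<Sum>i\<le>degree (coeff R j). coeff (if a * i + b * j = ?k then monom (coeff (coeff R j) i) i else 0) i0)
      = (if j = j0 then coeff (coeff R j0) i0 else 0)" (is "?l = _") for j
  proof -
    have "?l = (\<Sum>i\<le>degree (coeff R j). if i = i0 then (if j = j0 then coeff (coeff R j0) i0 else 0) else 0)"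
      by (intro sum.cong refl) (use \<open>b > 0\<close> in auto)
    also have "\<dots> = (if j = j0 then coeff (coeff R j0) i0 else 0)"
      by (auto simp: coeff_eq_0)
    finally show ?thesis .
  qed
  have "coeff G i0 = (\<Sum>j\<le>degree R. if j = j0 then coeff (coeff R j0) i0 else 0)"
    unfolding G_def coeff_sum inner ..
  also have "\<dots> = coeff (coeff R j0) i0"
    by (auto simp: coeff_eq_0)
  finally show ?thesis using \<open>G = 0\<close> by simp
qed

text \<open>
  The exponents multiply: each factor \<open>Q(\<tau>) - Y\<close> is of size \<open>max(\<bar>\<tau>\<bar>, w)\<^sup>b\<close>, and the product of
  the maxima over the fibre is of size \<open>w\<^sup>a\<close> by the Landau bound applied to \<open>P - X\<close>.
\<close>

lemma norm_fibre_poly_le: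
  assumes P: "degree P > 0" and w: "w > 0" and C: "C \<ge> 0"
    and circle: "\<And>t. norm t = w \<Longrightarrow> norm (poly P t - X) \<le> A * w ^ a"
    and fibre: "\<And>\<tau>. poly P \<tau> = X \<Longrightarrow> norm (poly Q \<tau> - Y) \<le> C * max (norm \<tau>) w ^ b"
  shows "norm (poly (fibre_poly P Q X) Y)
    \<le> C ^ degree P * (A / norm (lead_coeff P)) ^ b * w ^ (a * b)"
proof -
  let ?M = "proots (P - [:X:])"
  let ?m = "\<Prod>\<tau>\<in>#?M. max (norm \<tau>) w"
  have lc: "norm (lead_coeff P) > 0" using P by auto
  have "norm (lead_coeff P) * ?m \<le> A * w ^ a"
    using lead_coeff_prod_max_roots_le[OF w, of "P - [:X:]" "A * w ^ a"] circle
    unfolding lead_coeff_diff_const[OF P] by simp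
  then have m: "?m \<le> A / norm (lead_coeff P) * w ^ a" using lc by (simp add: field_simps)
  have "?m \<ge> 0" using prod_mset_mono_nonneg[of ?M "\<lambda>_. 0" "\<lambda>\<tau>. max (norm \<tau>) w"]
    prod_mset_mono_nonneg[of ?M "\<lambda>\<tau>. max (norm \<tau>) w" "\<lambda>\<tau>. max (norm \<tau>) w"] w by force
  have "norm (poly (fibre_poly P Q X) Y) = (\<Prod>\<tau>\<in>#?M. norm (poly Q \<tau> - Y))"
    by (simp add: poly_fibre_poly norm_prod_mset)
  also have "\<dots> \<le> (\<Prod>\<tau>\<in>#?M. C * max (norm \<tau>) w ^ b)"
    using prod_mset_mono_nonneg[of ?M "\<lambda>\<tau>. norm (poly Q \<tau> - Y)"] fibre
    by (simp add: in_proots_diff_const[OF P])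
  also have "\<dots> = C ^ degree P * ?m ^ b"
    by (simp add: prod_mset_const_mult prod_mset_power size_proots_diff_const)
  also have "\<dots> \<le> C ^ degree P * (A / norm (lead_coeff P) * w ^ a) ^ b"
    using m \<open>?m \<ge> 0\<close> C by (intro mult_left_mono power_mono) auto
  also have "\<dots> = C ^ degree P * (A / norm (lead_coeff P)) ^ b * w ^ (a * b)"
    by (simp only: power_mult_distrib power_mult mult.assoc)
  finally show ?thesis .
qed

definition coeff_norm_sum :: "complex poly \<Rightarrow> real" where
  "coeff_norm_sum P = (\<Sum>k\<le>degree P. norm (coeff P k))"

lemma coeff_norm_sum_nonneg: "coeff_norm_sum P \<ge> 0"
  by (simp add: coeff_norm_sum_def sum_nonneg)

text \<open>
  With \<open>e = 0\<close> and \<open>M = norm t\<close> this controls the growth of \<open>P\<close> at infinity, with \<open>M\<close> fixed its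
  decay at \<open>0\<close>.
\<close>

lemma norm_poly_le_low_order:
  assumes "norm t \<le> M" "1 \<le> M" and low: "\<And>k. k < e \<Longrightarrow> coeff P k = 0"
  shows "norm (poly P t) \<le> coeff_norm_sum P * M ^ degree P * norm t ^ e"
proof -
  have "norm (coeff P k * t ^ k) \<le> norm (coeff P k) * (M ^ degree P * norm t ^ e)"
    if "k \<le> degree P" for k
  proof (cases "k < e")
    case False
    have "norm t ^ k = norm t ^ (k - e) * norm t ^ e"
      using False by (simp flip: power_add)
    also have "norm t ^ (k - e) \<le> M ^ (k - e)" using assms by (intro power_mono) auto
    also have "M ^ (k - e) \<le> M ^ degree P" using assms that by (intro power_increasing) auto
    finally show ?thesis
      by (simp add: norm_mult norm_power mult_left_mono mult_right_mono)
  qed (simp add: low)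
  then have "(\<Sum>k\<le>degree P. norm (coeff P k * t ^ k))
    \<le> (\<Sum>k\<le>degree P. norm (coeff P k) * (M ^ degree P * norm t ^ e))"
    by (intro sum_mono) auto
  also have "\<dots> = coeff_norm_sum P * M ^ degree P * norm t ^ e"
    by (simp only: coeff_norm_sum_def sum_distrib_right mult.assoc)
  finally show ?thesis
    unfolding poly_altdef[of P] by (intro order.trans[OF norm_sum])
qed

lemma fibre_poly_growth:
  assumes P: "degree P > 0" and w: "1 \<le> w"
  shows "norm (poly (fibre_poly P Q (of_real w ^ degree P * x)) (of_real w ^ degree Q))
    \<le> (coeff_norm_sum Q + 1) ^ degree P * ((coeff_norm_sum P + norm x) / norm (lead_coeff P)) ^ degree Q
        * w ^ (degree P * degree Q)"
proof (rule norm_fibre_poly_le[OF P])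
  show "w > 0" using w by simp
  show "coeff_norm_sum Q + 1 \<ge> 0" using coeff_norm_sum_nonneg[of Q] by simp
  show "norm (poly P t - of_real w ^ degree P * x) \<le> (coeff_norm_sum P + norm x) * w ^ degree P"
    if "norm t = w" for t
    using norm_poly_le_low_order[of t w 0 P] that w
      norm_triangle_ineq4[of "poly P t" "of_real w ^ degree P * x"]
    by (simp add: norm_mult norm_power algebra_simps)
  show "norm (poly Q \<tau> - of_real w ^ degree Q) \<le> (coeff_norm_sum Q + 1) * max (norm \<tau>) w ^ degree Q" for \<tau>
  proof -
    have "w ^ degree Q \<le> max (norm \<tau>) w ^ degree Q" using w by (intro power_mono) auto
    moreover have "1 \<le> max (norm \<tau>) w" using w by simp
    ultimately show ?thesis
      using norm_poly_le_low_order[of \<tau> "max (norm \<tau>) w" 0 Q] w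
        norm_triangle_ineq4[of "poly Q \<tau>" "of_real w ^ degree Q"]
      by (simp add: norm_power algebra_simps)
  qed
qed

text \<open>
  The Landau bound on the unit circle: every factor of the product is at least \<open>1\<close>, so each root
  alone is bounded by the product.
\<close>

lemma root_bound:
  assumes P: "degree P > 0" and "poly P \<tau> = X"
  shows "norm \<tau> \<le> (coeff_norm_sum P + norm X) / norm (lead_coeff P)"
proof -
  let ?M = "proots (P - [:X:])"
  have "norm (poly (P - [:X:]) t) \<le> coeff_norm_sum P + norm X" if "norm t = 1" for t
    using norm_poly_le_low_order[of t 1 0 P] that norm_triangle_ineq4[of "poly P t" X] by simp
  then have *: "norm (lead_coeff P) * (\<Prod>\<tau>\<in>#?M. max (norm \<tau>) 1) \<le> coeff_norm_sum P + norm X"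
    using lead_coeff_prod_max_roots_le[of 1 "P - [:X:]"] unfolding lead_coeff_diff_const[OF P] by simp
  have "\<tau> \<in># ?M" using assms in_proots_diff_const by blast
  then obtain N where N: "?M = add_mset \<tau> N" by (metis insert_DiffM)
  have "1 \<le> (\<Prod>\<tau>\<in>#N. max (norm \<tau>) 1)"
    using prod_mset_mono_nonneg[of N "\<lambda>_. 1" "\<lambda>\<tau>. max (norm \<tau>) 1"] by simp
  then have "max (norm \<tau>) 1 * 1 \<le> (\<Prod>\<tau>\<in>#?M. max (norm \<tau>) 1)"
    unfolding N by (simp only: image_mset_add_mset prod_mset.add_mset) (intro mult_left_mono, auto)
  then have "norm \<tau> \<le> (\<Prod>\<tau>\<in>#?M. max (norm \<tau>) 1)" by simp
  moreover have "norm (lead_coeff P) > 0" using P by auto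
  ultimately have "norm (lead_coeff P) * norm \<tau> \<le> coeff_norm_sum P + norm X"
    using * by (meson mult_left_mono order.trans less_imp_le)
  with \<open>norm (lead_coeff P) > 0\<close> show ?thesis by (simp add: field_simps)
qed

text \<open>
  Only part of the fibre over \<open>X = w\<^sup>a x\<close> tends to \<open>0\<close> with \<open>w\<close>; the other roots merely stay
  bounded, by \<open>K\<close>. Hence the estimate of \<open>Q(\<tau>)\<close> uses the order of \<open>Q\<close> at \<open>0\<close> with a constant
  that depends on \<open>K\<close>, and holds for all roots of the fibre alike.
\<close>

lemma fibre_poly_decay:
  fixes P Q :: "complex poly" and x :: complex
  assumes P: "degree P > 0" and w: "0 < w" "w \<le> 1"
    and a: "\<And>k. k < a \<Longrightarrow> coeff P k = 0" and b: "\<And>k. k < b \<Longrightarrow> coeff Q k = 0"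
  defines "K \<equiv> (coeff_norm_sum P + norm x) / norm (lead_coeff P)"
  shows "norm (poly (fibre_poly P Q (of_real w ^ a * x)) (of_real w ^ b))
    \<le> (coeff_norm_sum Q * max 1 K ^ degree Q + 1) ^ degree P * K ^ b * w ^ (a * b)"
  unfolding K_def
proof (rule norm_fibre_poly_le[OF P \<open>0 < w\<close>], fold K_def)
  show "0 \<le> coeff_norm_sum Q * max 1 K ^ degree Q + 1"
    using coeff_norm_sum_nonneg[of Q] by (simp add: add_nonneg_nonneg)
  show "norm (poly P t - of_real w ^ a * x) \<le> (coeff_norm_sum P + norm x) * w ^ a"
    if "norm t = w" for t
    using norm_poly_le_low_order[of t 1 a P] that w a
      norm_triangle_ineq4[of "poly P t" "of_real w ^ a * x"]
    by (simp add: norm_mult norm_power algebra_simps)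
  fix \<tau> assume \<tau>: "poly P \<tau> = of_real w ^ a * x"
  have "norm (of_real w ^ a * x) \<le> norm x"
    using w by (simp add: norm_mult norm_power mult_left_le_one_le power_le_one)
  then have "norm \<tau> \<le> K"
    unfolding K_def by (intro order.trans[OF root_bound[OF P \<tau>]] divide_right_mono) auto
  then have "norm (poly Q \<tau>) \<le> coeff_norm_sum Q * max 1 K ^ degree Q * norm \<tau> ^ b"
    using b by (intro norm_poly_le_low_order) auto
  also have "\<dots> \<le> coeff_norm_sum Q * max 1 K ^ degree Q * max (norm \<tau>) w ^ b"
    using coeff_norm_sum_nonneg[of Q] by (intro mult_left_mono power_mono) auto
  finally have "norm (poly Q \<tau>) \<le> coeff_norm_sum Q * max 1 K ^ degree Q * max (norm \<tau>) w ^ b" .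
  moreover have "w ^ b \<le> max (norm \<tau>) w ^ b" using w by (intro power_mono) auto
  ultimately show "norm (poly Q \<tau> - of_real w ^ b)
      \<le> (coeff_norm_sum Q * max 1 K ^ degree Q + 1) * max (norm \<tau>) w ^ b"
    using norm_triangle_ineq4[of "poly Q \<tau>" "of_real w ^ b"] w
    by (simp add: norm_power algebra_simps)
qed

text \<open>
  The weights \<open>deg P\<close> and \<open>deg Q\<close> are the pole orders of \<open>x\<close> and \<open>y\<close> at \<open>t = \<infinity>\<close>; this is the edge
  of the Newton polygon that faces away from the origin.
\<close>

lemma eliminant_upper_weight:
  assumes "degree P > 0" "degree Q > 0"
    and R: "\<And>x y. eval_xy R x y = poly (fibre_poly P Q x) y"
    and "coeff (coeff R j) i \<noteq> 0"
  shows "degree P * i + degree Q * j \<le> degree P * degree Q"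
proof (rule ccontr)
  assume "\<not> ?thesis"
  then have "coeff (weighted_curve_poly (degree P) (degree Q) R x) (degree P * i + degree Q * j) = 0" for x
    by (intro coeff_eq_0_if_small_growth)
       (simp_all add: poly_weighted_curve_poly R, rule fibre_poly_growth, use assms in auto)
  then show False using coeff_weighted_curve_poly_zero assms by blast
qed

text \<open>
  With \<open>a\<close> and \<open>b\<close> the orders of \<open>P\<close> and \<open>Q\<close> at \<open>t = 0\<close>, this is the edge that faces the
  origin.
\<close>

lemma eliminant_lower_weight:
  assumes "degree P > 0"
    and R: "\<And>x y. eval_xy R x y = poly (fibre_poly P Q x) y"
    and a: "\<And>k. k < a \<Longrightarrow> coeff P k = 0" and b: "\<And>k. k < b \<Longrightarrow> coeff Q k = 0"
    and "coeff (coeff R j) i \<noteq> 0"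
  shows "a * b \<le> a * i + b * j"
proof (rule ccontr)
  assume less: "\<not> ?thesis"
  then have "b > 0" by (intro gr0I) auto
  have "coeff (weighted_curve_poly a b R x) (a * i + b * j) = 0" for x
    by (rule coeff_eq_0_if_small_near_0[where N = "a * b"])
       (simp_all add: poly_weighted_curve_poly R, rule fibre_poly_decay, use assms less in auto)
  then show False using coeff_weighted_curve_poly_zero[OF \<open>b > 0\<close>] assms by blast
qed

section \<open>The eliminant on the coordinate axes\<close>

lemma eval_xy_conv_map_poly: "eval_xy R x y = poly (map_poly (\<lambda>p. poly p x) R) y"
  unfolding eval_xy_def by (induction R) (simp_all add: map_poly_pCons)

lemma eval_xy_mult: "eval_xy (p * q) x y = eval_xy p x y * eval_xy q x y"
  by (simp add: eval_xy_def)

lemma coeff_prod_mset_linear_zeros: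
  fixes f :: "'a \<Rightarrow> complex"
  shows "coeff (\<Prod>s\<in>#M. [:f s, -1:]) (size {#s \<in># M. f s = 0#}) \<noteq> 0
    \<and> (\<forall>k < size {#s \<in># M. f s = 0#}. coeff (\<Prod>s\<in>#M. [:f s, -1:]) k = 0)"
proof (induction M)
  case (add a M)
  show ?case
  proof (cases "f a = 0")
    case True
    then show ?thesis using add by (auto simp: coeff_pCons split: nat.split)
  next
    case False
    then show ?thesis using add by (auto simp: coeff_pCons split: nat.split)
  qed
qed simp

lemma order_0_eqI:
  assumes "coeff Q e \<noteq> 0" and "\<And>k. k < e \<Longrightarrow> coeff Q k = 0"
  shows "order 0 Q = e"
proof -
  have "Q \<noteq> 0" using assms by auto
  then have *: "n \<le> order 0 Q \<longleftrightarrow> (\<forall>k<n. coeff Q k = 0)" for n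
    using monom_1_dvd_iff[of Q n] monom_1_dvd_iff'[of n Q] by simp
  from *[of e] *[of "Suc e"] assms show ?thesis by (auto simp: not_less_eq_eq intro: antisym)
qed

text \<open>
  The order at \<open>0\<close> of the eliminant restricted to the \<open>x\<close>-axis. Zeros are counted with their
  multiplicity in \<open>Q\<close> only, so the two arguments are not interchangeable.
\<close>

definition common_zeros :: "complex poly \<Rightarrow> complex poly \<Rightarrow> nat" where
  "common_zeros P Q = size {#s \<in># proots Q. poly P s = 0#}"

lemma common_zeros_eq_0:
  assumes "Q \<noteq> 0" and "\<And>t. poly P t \<noteq> 0 \<or> poly Q t \<noteq> 0"
  shows "common_zeros P Q = 0"
proof -
  have "{#s \<in># proots Q. poly P s = 0#} = {#s \<in># proots Q. False#}"
    using assms by (intro filter_mset_cong) auto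
  then show ?thesis by (simp add: common_zeros_def)
qed

lemma common_zeros_eq_order:
  assumes "Q \<noteq> 0" and "poly P 0 = 0" and "\<And>t. t \<noteq> 0 \<Longrightarrow> poly P t \<noteq> 0 \<or> poly Q t \<noteq> 0"
  shows "common_zeros P Q = order 0 Q"
proof -
  have "{#s \<in># proots Q. poly P s = 0#} = {#s \<in># proots Q. s = 0#}"
    using assms by (intro filter_mset_cong) auto
  also have "size \<dots> = order 0 Q"
    using assms(1) by (simp add: filter_eq_replicate_mset)
  finally show ?thesis by (simp add: common_zeros_def)
qed

context
  fixes P Q :: "complex poly" and R :: "complex poly poly"
  assumes P: "degree P > 0" and Q: "degree Q > 0"
    and R: "\<And>x y. eval_xy R x y = poly (fibre_poly P Q x) y"
begin

lemma eliminant_specialize: "map_poly (\<lambda>p. poly p x) R = fibre_poly P Q x"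
  using R[of x] by (intro poly_ext) (simp add: eval_xy_conv_map_poly)

text \<open>
  On the \<open>y\<close>-axis the eliminant is \<open>\<Prod> (Q(\<tau>) - y)\<close> over the roots of \<open>P\<close>: its degree is the number
  of factors and its order at \<open>0\<close> the number of vanishing \<open>Q(\<tau>)\<close>.
\<close>

lemma eliminant_coeffs_on_y_axis:
  "coeff (coeff R (degree P)) 0 \<noteq> 0" "coeff (coeff R (common_zeros Q P)) 0 \<noteq> 0"
proof -
  have *: "coeff (coeff R j) 0 = coeff (fibre_poly P Q 0) j" for j
    using arg_cong[OF eliminant_specialize[of 0], of "\<lambda>p. coeff p j"]
    by (simp add: coeff_map_poly poly_0_coeff_0)
  show "coeff (coeff R (degree P)) 0 \<noteq> 0"
    unfolding * using degree_fibre_poly[of P Q 0] fibre_poly_nonzero[of P Q 0]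
    by (metis leading_coeff_0_iff)
  show "coeff (coeff R (common_zeros Q P)) 0 \<noteq> 0"
    unfolding * fibre_poly_def common_zeros_def
    using coeff_prod_mset_linear_zeros[of "poly Q" "proots P"] by simp
qed

text \<open>
  The mirror image of the previous lemma, by the symmetry of the fibre products.
\<close>

lemma eliminant_coeffs_on_x_axis:
  "coeff (coeff R 0) (degree Q) \<noteq> 0" "coeff (coeff R 0) (common_zeros P Q) \<noteq> 0"
proof -
  define c where "c = (-1) ^ (degree P * degree Q) * lead_coeff Q ^ degree P / lead_coeff P ^ degree Q"
  have lc: "lead_coeff P \<noteq> 0" "lead_coeff Q \<noteq> 0" using P Q by auto
  then have c: "c \<noteq> 0" by (simp add: c_def)
  have "poly (coeff R 0) x = poly (smult c (fibre_poly Q P 0)) x" for x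
  proof -
    have "poly (coeff R 0) x = eval_xy R x 0" by (simp add: eval_xy_def poly_0_coeff_0)
    also have "\<dots> = c * poly (fibre_poly Q P 0) x"
      using fibre_poly_swap[OF P Q, of x 0] lc by (simp add: R c_def field_simps)
    finally show ?thesis by simp
  qed
  then have *: "coeff R 0 = smult c (fibre_poly Q P 0)" by (intro poly_ext) auto
  show "coeff (coeff R 0) (degree Q) \<noteq> 0"
    unfolding * using c degree_fibre_poly[of Q P 0] fibre_poly_nonzero[of Q P 0]
    by (metis coeff_smult leading_coeff_0_iff mult_eq_0_iff)
  show "coeff (coeff R 0) (common_zeros P Q) \<noteq> 0"
    unfolding * fibre_poly_def common_zeros_def
    using c coeff_prod_mset_linear_zeros[of "poly P" "proots Q"] by simp
qed

section \<open>The eliminant is the implicit equation\<close>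

lemma eliminant_in_vanishing_ideal: "R \<in> vanishing_ideal P Q"
proof -
  have "eval_xy R (poly P t) (poly Q t) = 0" for t
  proof -
    have "t \<in># proots (P - [:poly P t:])" using in_proots_diff_const[OF P] by simp
    then show ?thesis by (auto simp: R poly_fibre_poly prod_mset_zero_iff)
  qed
  then show ?thesis by (simp add: vanishing_ideal_def)
qed

text \<open>
  This is where the degree of the parameterization enters. Over a generic \<open>x\<close> the fibre of \<open>P\<close> has
  \<open>deg P\<close> distinct points, \<open>Q\<close> separates them, and \<open>\<phi>(x, \<cdot>)\<close> vanishes at all their values. That
  \<open>\<phi>\<close> divides the eliminant ensures \<open>\<phi>(x, \<cdot>) \<noteq> 0\<close>.
\<close>

lemma degree_vanishing_factor_ge:
  assumes deg1: "has_param_degree P Q 1" and \<phi>: "\<phi> \<in> vanishing_ideal P Q" and dvd: "\<phi> dvd R"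
  shows "degree P \<le> degree \<phi>"
proof -
  \<comment> \<open>parameters that share their curve point with another parameter, and critical points of \<open>P\<close>\<close>
  define B where "B = {t. card {s. poly P s = poly P t \<and> poly Q s = poly Q t} \<noteq> 1}"
  define D where "D = {t. poly (pderiv P) t = 0}"
  have "pderiv P \<noteq> 0" using P by (simp add: pderiv_eq_0_iff)
  then have "finite (poly P ` (B \<union> D))"
    using deg1 poly_roots_finite by (auto simp: B_def D_def has_param_degree_def)
  then obtain x where x: "x \<notin> poly P ` (B \<union> D)"
    using infinite_UNIV_char_0[where 'a = complex] ex_new_if_finite by blast
  define A where "A = {\<tau>. poly P \<tau> = x}"
  have "order t (P - [:x:]) \<le> 1" for t
  proof (rule ccontr)
    assume "\<not> order t (P - [:x:]) \<le> 1"
    moreover have "rsquarefree (P - [:x:])"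
      unfolding rsquarefree_roots using x by (auto simp: D_def pderiv_diff pderiv_pCons)
    ultimately show False unfolding rsquarefree_def by (metis le_numeral_extra(4) zero_le)
  qed
  moreover have "order t (P - [:x:]) = 0 \<longleftrightarrow> t \<notin> A" for t
    using diff_const_nonzero[OF P, of x] order_root[of "P - [:x:]" t] by (simp add: A_def)
  ultimately have "order t (P - [:x:]) = (if t \<in> A then 1 else 0)" for t
    by (metis le_neq_implies_less less_one)
  moreover have "finite A"
    using poly_roots_finite[OF diff_const_nonzero[OF P, of x]] by (simp add: A_def)
  ultimately have "proots (P - [:x:]) = mset_set A"
    using diff_const_nonzero[OF P, of x] by (intro multiset_eqI) (simp add: count_mset_set')
  then have card: "card A = degree P" using size_proots_diff_const[of P x] by simp
  have "inj_on (poly Q) A"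
  proof (rule inj_onI)
    fix s t assume st: "s \<in> A" "t \<in> A" "poly Q s = poly Q t"
    then have "poly P t = x" by (simp add: A_def)
    then have "t \<notin> B" using x by (metis UnI1 imageI)
    then obtain u where "{s. poly P s = poly P t \<and> poly Q s = poly Q t} = {u}"
      unfolding B_def by (auto simp: card_1_singleton_iff)
    moreover have "s \<in> {s. poly P s = poly P t \<and> poly Q s = poly Q t}"
      using st by (simp add: A_def)
    moreover have "t \<in> {s. poly P s = poly P t \<and> poly Q s = poly Q t}" by simp
    ultimately show "s = t" by (metis singletonD)
  qed
  then have card': "card (poly Q ` A) = degree P" using card card_image by metis
  let ?p = "map_poly (\<lambda>p. poly p x) \<phi>"
  obtain q where q: "R = \<phi> * q" using dvd by blast
  have "?p \<noteq> 0"
  proof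
    assume "?p = 0"
    then have "poly (fibre_poly P Q x) y = 0" for y
      using R[of x y] by (simp add: q eval_xy_mult eval_xy_conv_map_poly[of \<phi>])
    then show False using fibre_poly_nonzero poly_all_0_iff_0 by blast
  qed
  have "poly Q ` A \<subseteq> {y. poly ?p y = 0}"
    using \<phi> by (auto simp: A_def vanishing_ideal_def simp flip: eval_xy_conv_map_poly)
  then have "degree P \<le> card {y. poly ?p y = 0}"
    using card' card_mono[OF poly_roots_finite[OF \<open>?p \<noteq> 0\<close>]] by metis
  also have "\<dots> \<le> degree ?p" using \<open>?p \<noteq> 0\<close> by (rule card_poly_roots_bound)
  also have "\<dots> \<le> degree \<phi>" by (rule map_poly_degree_leq)
  finally show ?thesis .
qed

text \<open>
  The cofactor of \<open>\<phi>\<close> in \<open>R\<close> has degree \<open>0\<close> in \<open>y\<close> by the degree count. As a polynomial in \<open>x\<close> it has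
  no root, because \<open>R(x, \<cdot>)\<close> is nonzero for every single \<open>x\<close>.
\<close>

lemma implicit_equation_eliminant:
  assumes "degree R \<le> degree P" and deg1: "has_param_degree P Q 1" and \<phi>: "implicit_equation P Q \<phi>"
  shows "\<exists>c. c \<noteq> 0 \<and> R = \<phi> * [:[:c:]:]"
proof -
  have "\<phi> \<in> vanishing_ideal P Q" "\<phi> dvd R"
    using \<phi> eliminant_in_vanishing_ideal by (auto simp: implicit_equation_def)
  then have ge: "degree P \<le> degree \<phi>" using degree_vanishing_factor_ge[OF deg1] by blast
  obtain q where q: "R = \<phi> * q" using \<open>\<phi> dvd R\<close> by blast
  have "R \<noteq> 0" using eliminant_coeffs_on_x_axis by auto
  then have "degree R = degree \<phi> + degree q" using degree_mult_eq[of \<phi> q] unfolding q by auto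
  then obtain q0 where q0: "q = [:q0:]" using ge assms(1) by (metis add_leE add_le_same_cancel1 degree_eq_zeroE le_trans le_zero_eq)
  have "degree q0 = 0"
  proof (rule ccontr)
    assume "degree q0 \<noteq> 0"
    then obtain x where "poly q0 x = 0"
      using fundamental_theorem_of_algebra[of q0] constant_degree[of q0] by auto
    moreover have "poly (fibre_poly P Q x) y = eval_xy \<phi> x y * eval_xy [:q0:] x y" for y
      unfolding R[symmetric] q q0 eval_xy_mult ..
    ultimately have "poly (fibre_poly P Q x) y = 0" for y
      by (simp add: eval_xy_def[of "[:q0:]"])
    then show False using fibre_poly_nonzero poly_all_0_iff_0 by blast
  qed
  then obtain c where "q0 = [:c:]" by (metis degree_eq_zeroE)
  with q q0 \<open>R \<noteq> 0\<close> show ?thesis by (intro exI[of _ c]) auto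
qed

end

section \<open>Newton polygon of the implicit equation\<close>

lemma convex_hull_triangle_mem:
  assumes d: "0 < d0" "0 < d1" and le: "d0 * i + d1 * j \<le> d0 * d1"
  shows "(real i, real j) \<in> convex hull {(0, 0), (real d1, 0), (0, real d0)}"
proof -
  let ?u = "real i / real d1" and ?v = "real j / real d0"
  have "real d0 * real i + real d1 * real j \<le> real d0 * real d1"
    using le by (metis of_nat_add of_nat_le_iff of_nat_mult)
  then have "?u + ?v \<le> 1" using d by (simp add: field_simps)
  moreover have "(real i, real j) = (1 - ?u - ?v) *\<^sub>R (0, 0) + ?u *\<^sub>R (real d1, 0) + ?v *\<^sub>R (0, real d0)"
    using d by simp
  ultimately show ?thesis
    unfolding convex_hull_3
    by (intro CollectI exI[of _ "1 - ?u - ?v"] exI[of _ ?u] exI[of _ ?v]) auto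
qed

text \<open>
  The ray from the origin through \<open>(i, j)\<close> meets the outer edge at \<open>(i, j) / \<alpha>\<close> and the inner edge
  at \<open>(i, j) / \<beta>\<close>. The two inequalities say \<open>\<alpha> \<le> 1 \<le> \<beta>\<close>, so \<open>(i, j)\<close> lies between these points.
\<close>

lemma convex_hull_quadrilateral_mem:
  assumes d: "0 < d0" "0 < d1" "0 < e0" "0 < e1" and ge: "e0 * e1 \<le> e0 * i + e1 * j"
    and le: "d0 * i + d1 * j \<le> d0 * d1"
  shows "(real i, real j) \<in> convex hull {(real e1, 0), (real d1, 0), (0, real d0), (0, real e0)}"
    (is "_ \<in> ?H")
proof -
  define \<alpha> where "\<alpha> = real i / real d1 + real j / real d0"
  define \<beta> where "\<beta> = real i / real e1 + real j / real e0"
  have "real d0 * real i + real d1 * real j \<le> real d0 * real d1"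
    using le by (metis of_nat_add of_nat_le_iff of_nat_mult)
  then have \<alpha>1: "\<alpha> \<le> 1" using d by (simp add: field_simps \<alpha>_def)
  have "real e0 * real e1 \<le> real e0 * real i + real e1 * real j"
    using ge by (metis of_nat_add of_nat_le_iff of_nat_mult)
  then have \<beta>1: "1 \<le> \<beta>" using d by (simp add: field_simps \<beta>_def)
  have "i > 0 \<or> j > 0" using ge d by (auto intro!: gr0I)
  then have \<alpha>0: "\<alpha> > 0" using d by (auto simp: \<alpha>_def intro: add_pos_nonneg add_nonneg_pos)
  have edge: "(real i / \<gamma>, real j / \<gamma>) \<in> ?H"
    if \<gamma>: "\<gamma> = real i / real a + real j / real b" "\<gamma> > 0" "a > 0" "b > 0"
      and ab: "(real a, 0) \<in> ?H" "(0, real b) \<in> ?H" for \<gamma> a b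
  proof -
    have "(real i / real a / \<gamma>) *\<^sub>R (real a, 0) + (real j / real b / \<gamma>) *\<^sub>R (0, real b) \<in> ?H"
    proof (rule convexD[OF convex_convex_hull ab])
      show "real i / real a / \<gamma> + real j / real b / \<gamma> = 1"
        unfolding add_divide_distrib[symmetric] \<gamma>(1)[symmetric] using \<gamma>(2) by simp
    qed (use \<gamma> in auto)
    then show ?thesis using \<gamma>(3,4) by simp
  qed
  have outer: "(real i / \<alpha>, real j / \<alpha>) \<in> ?H"
    by (rule edge[OF \<alpha>_def \<alpha>0]) (use d in \<open>auto intro: hull_inc\<close>)
  have inner: "(real i / \<beta>, real j / \<beta>) \<in> ?H"
    by (rule edge[OF \<beta>_def]) (use d \<beta>1 in \<open>auto intro: hull_inc\<close>)
  \<comment> \<open>the weights solve \<open>u + v = 1\<close> and \<open>u / \<alpha> + v / \<beta> = 1\<close>\<close>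
  have "\<exists>u v. 0 \<le> u \<and> 0 \<le> v \<and> u + v = 1 \<and> u / \<alpha> + v / \<beta> = 1"
  proof (cases "\<alpha> = \<beta>")
    case True
    then show ?thesis using \<alpha>1 \<beta>1 by (intro exI[of _ 1] exI[of _ 0]) auto
  next
    case False
    then have "\<beta> - \<alpha> > 0" using \<alpha>1 \<beta>1 by simp
    then show ?thesis using \<alpha>0 \<alpha>1 \<beta>1
      by (intro exI[of _ "\<alpha> * (\<beta> - 1) / (\<beta> - \<alpha>)"] exI[of _ "\<beta> * (1 - \<alpha>) / (\<beta> - \<alpha>)"])
         (auto simp: divide_simps, auto simp: algebra_simps)
  qed
  then obtain u v where uv: "0 \<le> u" "0 \<le> v" "u + v = 1" "u / \<alpha> + v / \<beta> = 1" by blast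
  have "u *\<^sub>R (real i / \<alpha>, real j / \<alpha>) + v *\<^sub>R (real i / \<beta>, real j / \<beta>) \<in> ?H"
    using convexD[OF convex_convex_hull outer inner uv(1-3)] .
  also have "u *\<^sub>R (real i / \<alpha>, real j / \<alpha>) + v *\<^sub>R (real i / \<beta>, real j / \<beta>)
      = ((u / \<alpha> + v / \<beta>) * real i, (u / \<alpha> + v / \<beta>) * real j)"
    by (simp add: algebra_simps)
  finally show ?thesis by (simp add: uv)
qed

lemma newton_polygon_eqI:
  assumes "\<And>i j. coeff (coeff q j) i \<noteq> 0 \<Longrightarrow> (real i, real j) \<in> convex hull V"
    and "\<And>v. v \<in> V \<Longrightarrow> \<exists>i j. v = (real i, real j) \<and> coeff (coeff q j) i \<noteq> 0"
  shows "newton_polygon q = convex hull V"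
  unfolding newton_polygon_def
proof (rule subset_antisym)
  show "convex hull {(real i, real j) |i j. coeff (coeff q j) i \<noteq> 0} \<subseteq> convex hull V"
    using assms(1) by (intro hull_minimal) auto
  show "convex hull V \<subseteq> convex hull {(real i, real j) |i j. coeff (coeff q j) i \<noteq> 0}"
    using assms(2) by (intro hull_mono) fast
qed

text \<open>
  The weight bounds put every exponent vector into the polygon, and the monomials on the axes are
  its vertices. The hypothesis excludes common zeros outside \<open>0\<close>; so the number of common zeros,
  which gives the vertices next to the origin, is the order of vanishing at \<open>t = 0\<close>, or \<open>0\<close> if
  a constant term is present.
\<close>

theorem newton_polygon_implicit_equation:
  fixes P Q :: "complex poly"
  assumes P: "degree P > 0" and Q: "degree Q > 0"
    and deg1: "has_param_degree P Q 1" and \<phi>: "implicit_equation P Q \<phi>"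
    and no_common: "\<And>t. t \<noteq> 0 \<Longrightarrow> poly P t \<noteq> 0 \<or> poly Q t \<noteq> 0"
  shows "coeff P 0 \<noteq> 0 \<or> coeff Q 0 \<noteq> 0 \<Longrightarrow>
      newton_polygon \<phi> = convex hull {(0, 0), (real (degree Q), 0), (0, real (degree P))}"
    and "coeff P 0 = 0 \<and> coeff Q 0 = 0 \<Longrightarrow>
      newton_polygon \<phi> = convex hull {(real (order 0 Q), 0), (real (degree Q), 0),
        (0, real (degree P)), (0, real (order 0 P))}"
proof -
  have "P \<noteq> 0" "Q \<noteq> 0" using P Q by auto
  obtain R where R: "degree R \<le> degree P" "\<And>x y. eval_xy R x y = poly (fibre_poly P Q x) y"
    using exists_eliminant[OF P Q] by blast
  obtain c where "c \<noteq> 0" "R = \<phi> * [:[:c:]:]"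
    using implicit_equation_eliminant[OF P Q R(2,1) deg1 \<phi>] by blast
  then have supp: "coeff (coeff \<phi> j) i \<noteq> 0 \<longleftrightarrow> coeff (coeff R j) i \<noteq> 0" for i j by simp
  note x_axis = eliminant_coeffs_on_x_axis[OF P Q R(2), folded supp]
  note y_axis = eliminant_coeffs_on_y_axis[OF P Q R(2), folded supp]
  have upper: "coeff (coeff \<phi> j) i \<noteq> 0 \<Longrightarrow> degree P * i + degree Q * j \<le> degree P * degree Q" for i j
    using eliminant_upper_weight[OF P Q R(2)] supp by blast
  show "newton_polygon \<phi> = convex hull {(0, 0), (real (degree Q), 0), (0, real (degree P))}"
    if "coeff P 0 \<noteq> 0 \<or> coeff Q 0 \<noteq> 0"
  proof (rule newton_polygon_eqI)
    have "poly P t \<noteq> 0 \<or> poly Q t \<noteq> 0" for t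
      using no_common[of t] that by (cases "t = 0") (auto simp: poly_0_coeff_0)
    then have "common_zeros P Q = 0" using \<open>Q \<noteq> 0\<close> by (intro common_zeros_eq_0) auto
    then have "coeff (coeff \<phi> 0) 0 \<noteq> 0" using x_axis by simp
    then show "\<exists>i j. v = (real i, real j) \<and> coeff (coeff \<phi> j) i \<noteq> 0"
      if "v \<in> {(0, 0), (real (degree Q), 0), (0, real (degree P))}" for v
      using that x_axis y_axis by (metis empty_iff insert_iff of_nat_0)
  qed (use upper P Q convex_hull_triangle_mem in blast)
  show "newton_polygon \<phi> = convex hull {(real (order 0 Q), 0), (real (degree Q), 0),
      (0, real (degree P)), (0, real (order 0 P))}"
    if coeff0: "coeff P 0 = 0 \<and> coeff Q 0 = 0"
  proof (rule newton_polygon_eqI)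
    have "common_zeros P Q = order 0 Q" "common_zeros Q P = order 0 P"
      using \<open>P \<noteq> 0\<close> \<open>Q \<noteq> 0\<close> coeff0 no_common
      by (auto intro!: common_zeros_eq_order simp: poly_0_coeff_0)
    then show "\<exists>i j. v = (real i, real j) \<and> coeff (coeff \<phi> j) i \<noteq> 0"
      if "v \<in> {(real (order 0 Q), 0), (real (degree Q), 0), (0, real (degree P)), (0, real (order 0 P))}" for v
      using that x_axis y_axis by (metis empty_iff insert_iff of_nat_0)
    fix i j assume ij: "coeff (coeff \<phi> j) i \<noteq> 0"
    have low: "coeff p k = 0" if "k < order 0 p" "p \<noteq> 0" for p :: "complex poly" and k
      using that monom_1_dvd_iff[of p "order 0 p"] monom_1_dvd_iff'[of "order 0 p" p] by auto
    have "order 0 P * order 0 Q \<le> order 0 P * i + order 0 Q * j"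
      by (rule eliminant_lower_weight[OF P R(2)]) (use low \<open>P \<noteq> 0\<close> \<open>Q \<noteq> 0\<close> ij supp in auto)
    moreover have "order 0 P > 0" "order 0 Q > 0"
      using coeff0 \<open>P \<noteq> 0\<close> \<open>Q \<noteq> 0\<close> by (auto simp: order_gt_0_iff poly_0_coeff_0)
    ultimately show "(real i, real j) \<in> convex hull {(real (order 0 Q), 0), (real (degree Q), 0),
      (0, real (degree P)), (0, real (order 0 P))}"
      using upper[OF ij] P Q by (intro convex_hull_quadrilateral_mem) auto
  qed
qed

section \<open>Genericity of having no common zero in the torus\<close>

lemma poly_sparse_poly: "poly (sparse_poly S c) t = (\<Sum>k\<in>S. c k * t ^ k)"
  by (simp add: sparse_poly_def poly_sum poly_monom)

lemma coeff_sparse_poly: "finite S \<Longrightarrow> coeff (sparse_poly S c) k = (if k \<in> S then c k else 0)"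
  by (simp add: sparse_poly_def coeff_sum)

text \<open>
  The nonzero roots of a sparse polynomial as a closed condition in projective coordinates
  \<open>t = u / v\<close>: the common power of \<open>t\<close> is removed first, so that neither \<open>u = 0\<close> nor \<open>v = 0\<close> can be
  a zero when the extremal coefficients do not vanish.
\<close>

definition homogenized :: "nat set \<Rightarrow> (nat \<Rightarrow> complex) \<Rightarrow> complex \<Rightarrow> complex \<Rightarrow> complex" where
  "homogenized S c u v = (\<Sum>k\<in>S. c k * (u ^ (k - Min S) * v ^ (Max S - k)))"

lemma homogenized_axis_nonzero:
  assumes S: "finite S" "S \<noteq> {}" and c: "\<And>k. k \<in> S \<Longrightarrow> c k \<noteq> 0"
  shows "v \<noteq> 0 \<Longrightarrow> homogenized S c 0 v \<noteq> 0" and "u \<noteq> 0 \<Longrightarrow> homogenized S c u 0 \<noteq> 0"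
proof -
  have "homogenized S c 0 v = (\<Sum>k\<in>S. if k = Min S then c (Min S) * v ^ (Max S - Min S) else 0)"
    unfolding homogenized_def
    by (intro sum.cong refl) (auto simp: power_0_left S Min_le_iff le_antisym)
  then show "v \<noteq> 0 \<Longrightarrow> homogenized S c 0 v \<noteq> 0" using S c by (simp add: Min_in)
  have "homogenized S c u 0 = (\<Sum>k\<in>S. if k = Max S then c (Max S) * u ^ (Max S - Min S) else 0)"
    unfolding homogenized_def
    by (intro sum.cong refl) (auto simp: power_0_left S Max_ge_iff le_antisym)
  then show "u \<noteq> 0 \<Longrightarrow> homogenized S c u 0 \<noteq> 0" using S c by (simp add: Max_in)
qed

lemma homogenized_dehomogenize:
  assumes S: "finite S" and v: "v \<noteq> 0"
  shows "u ^ Min S * homogenized S c u v = v ^ Max S * poly (sparse_poly S c) (u / v)"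
  unfolding homogenized_def poly_sparse_poly sum_distrib_left
proof (intro sum.cong refl)
  fix k assume k: "k \<in> S"
  have "u ^ Min S * (c k * (u ^ (k - Min S) * v ^ (Max S - k))) = c k * (u ^ (Min S + (k - Min S)) * v ^ (Max S - k))"
    by (simp add: power_add)
  also have "\<dots> = c k * (u ^ k * v ^ (Max S - k))" using S k by simp
  also have "\<dots> = v ^ Max S * (c k * (u / v) ^ k)" using S k v by (simp add: power_diff field_simps)
  finally show "u ^ Min S * (c k * (u ^ (k - Min S) * v ^ (Max S - k))) = v ^ Max S * (c k * (u / v) ^ k)" .
qed

lemma homogenized_zero_iff:
  assumes S: "finite S" "S \<noteq> {}" and c: "\<And>k. k \<in> S \<Longrightarrow> c k \<noteq> 0" and "(u, v) \<noteq> (0, 0)"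
  shows "homogenized S c u v = 0 \<longleftrightarrow> u \<noteq> 0 \<and> v \<noteq> 0 \<and> poly (sparse_poly S c) (u / v) = 0"
  using homogenized_axis_nonzero(1)[of S c v] homogenized_axis_nonzero(2)[of S c u] S c
    homogenized_dehomogenize[OF S(1), of v u c] assms(4)
  by (cases "u = 0"; cases "v = 0") auto

definition no_common_torus_zero ::
    "nat set \<Rightarrow> nat set \<Rightarrow> ((nat \<Rightarrow> complex) \<times> (nat \<Rightarrow> complex)) set" where
  "no_common_torus_zero S0 S1 = {(c0, c1) \<in> topspace (coeff_space S0 S1).
     \<forall>t. t \<noteq> 0 \<longrightarrow> poly (sparse_poly S0 c0) t \<noteq> 0 \<or> poly (sparse_poly S1 c1) t \<noteq> 0}"

lemma topspace_coeff_space: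
  "topspace (coeff_space S0 S1) = (\<Pi>\<^sub>E k\<in>S0. - {0}) \<times> (\<Pi>\<^sub>E k\<in>S1. - {0})"
  by (simp add: coeff_space_def)

lemma continuous_map_mult_complex:
  fixes f g :: "'a \<Rightarrow> complex"
  assumes "continuous_map X euclidean f" "continuous_map X euclidean g"
  shows "continuous_map X euclidean (\<lambda>x. f x * g x)"
  using assms by (simp add: continuous_map_atin tendsto_mult)

lemma continuous_map_homogenized:
  assumes S: "finite S" and c: "\<And>k. k \<in> S \<Longrightarrow> continuous_map Z euclidean (\<lambda>z. c z k)"
    and uv: "continuous_map Z euclidean uv"
  shows "continuous_map Z euclidean (\<lambda>z. homogenized S (c z) (fst (uv z)) (snd (uv z)))"
proof -
  have "continuous_map Z euclidean (\<lambda>z. fst (uv z) ^ a * snd (uv z) ^ b)" for a b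
    using uv by (simp add: continuous_map_atin tendsto_intros)
  then show ?thesis
    unfolding homogenized_def using S c
    by (intro continuous_map_sum continuous_map_mult_complex[of _ "\<lambda>z. c z _"]) auto
qed

text \<open>
  The complement is the projection to the coefficients of a closed condition on coefficients and
  \<open>(u, v)\<close>. By homogeneity \<open>(u, v)\<close> may be taken on the unit sphere of \<open>\<complex>\<^sup>2\<close>, and projection
  along a compact factor is a closed map.
\<close>

lemma openin_no_common_torus_zero:
  assumes S0: "finite S0" "S0 \<noteq> {}" and S1: "finite S1" "S1 \<noteq> {}"
  shows "openin (coeff_space S0 S1) (no_common_torus_zero S0 S1)"
proof -
  define X where "X = coeff_space S0 S1"
  define Y where "Y = top_of_set (sphere (0 :: complex \<times> complex) 1)"
  define F where "F z = (homogenized S0 (fst (fst z)) (fst (snd z)) (snd (snd z)),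
    homogenized S1 (snd (fst z)) (fst (snd z)) (snd (snd z)))"
    for z :: "((nat \<Rightarrow> complex) \<times> (nat \<Rightarrow> complex)) \<times> complex \<times> complex"
  have fst_X: "continuous_map X (product_topology (\<lambda>_. top_of_set (- {0})) S0) fst"
   and snd_X: "continuous_map X (product_topology (\<lambda>_. top_of_set (- {0})) S1) snd"
    unfolding X_def coeff_space_def by (rule continuous_map_fst continuous_map_snd)+
  have c0: "continuous_map (prod_topology X Y) euclidean (\<lambda>z. fst (fst z) k)" if "k \<in> S0" for k
    using continuous_map_compose[OF continuous_map_compose[OF continuous_map_fst fst_X]
        continuous_map_product_projection[OF that]]
    by (auto simp: o_def intro: continuous_map_into_fulltopology)
  have c1: "continuous_map (prod_topology X Y) euclidean (\<lambda>z. snd (fst z) k)" if "k \<in> S1" for k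
    using continuous_map_compose[OF continuous_map_compose[OF continuous_map_fst snd_X]
        continuous_map_product_projection[OF that]]
    by (auto simp: o_def intro: continuous_map_into_fulltopology)
  have uv: "continuous_map (prod_topology X Y) euclidean snd"
    using continuous_map_snd[of X Y] unfolding Y_def by (rule continuous_map_into_fulltopology)
  have "continuous_map (prod_topology X Y) (prod_topology euclidean euclidean) F"
    unfolding continuous_map_pairwise o_def F_def fst_conv snd_conv
    by (intro conjI continuous_map_homogenized S0 S1 c0 c1 uv)
  then have "continuous_map (prod_topology X Y) euclidean F" by simp
  then have "closedin (prod_topology X Y) {z \<in> topspace (prod_topology X Y). F z \<in> {0}}"
    by (rule closedin_continuous_map_preimage) simp
  moreover have "compact_space Y"
    unfolding Y_def by (simp add: compact_space_subtopology)
  ultimately have closed: "closedin X (fst ` {z \<in> topspace (prod_topology X Y). F z \<in> {0}})"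
    using closed_map_fst closed_map_def by blast
  have "topspace X - no_common_torus_zero S0 S1 = fst ` {z \<in> topspace (prod_topology X Y). F z \<in> {0}}"
    (is "?L = ?R")
  proof (rule set_eqI, rule iffI)
    fix c assume c: "c \<in> ?L"
    then obtain t where t: "t \<noteq> 0" "poly (sparse_poly S0 (fst c)) t = 0" "poly (sparse_poly S1 (snd c)) t = 0"
      by (auto simp: no_common_torus_zero_def X_def)
    \<comment> \<open>the representative of the projective point \<open>(t : 1)\<close> on the unit sphere\<close>
    define r where "r = inverse (norm (t, 1 :: complex))"
    have "norm (t, 1 :: complex) \<noteq> 0" by (simp add: zero_prod_def)
    then have r: "r \<noteq> 0" and "norm (r *\<^sub>R (t, 1 :: complex)) = 1"
      by (simp_all only: r_def norm_scaleR nonzero_imp_inverse_nonzero) simp_all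
    then have sphere: "(r *\<^sub>R t, of_real r) \<in> sphere (0 :: complex \<times> complex) 1"
      by (simp add: scaleR_conv_of_real)
    have "r *\<^sub>R t / of_real r = t" using r by (simp add: scaleR_conv_of_real)
    moreover have "(r *\<^sub>R t, of_real r :: complex) \<noteq> (0, 0)" using r by simp
    ultimately have "F (c, (r *\<^sub>R t, of_real r)) = 0"
      using c t r homogenized_zero_iff[OF S0, of "fst c" "r *\<^sub>R t" "of_real r"]
        homogenized_zero_iff[OF S1, of "snd c" "r *\<^sub>R t" "of_real r"]
      by (auto simp: F_def zero_prod_def X_def topspace_coeff_space PiE_iff)
    with sphere show "c \<in> ?R"
      using c by (intro image_eqI[of _ _ "(c, (r *\<^sub>R t, of_real r))"]) (auto simp: Y_def)
  next
    fix c assume "c \<in> ?R"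
    then obtain u v where c: "c \<in> topspace X" "(u, v) \<in> sphere 0 1" "F (c, u, v) = 0"
      by (force simp: Y_def)
    then have "(u, v) \<noteq> (0, 0)" by (auto simp flip: zero_prod_def)
    then have "u / v \<noteq> 0 \<and> poly (sparse_poly S0 (fst c)) (u / v) = 0 \<and> poly (sparse_poly S1 (snd c)) (u / v) = 0"
      using c homogenized_zero_iff[OF S0, of "fst c" u v] homogenized_zero_iff[OF S1, of "snd c" u v]
      by (auto simp: F_def zero_prod_def X_def topspace_coeff_space PiE_iff)
    then show "c \<in> ?L" using c by (auto simp: no_common_torus_zero_def)
  qed
  then have "closedin X (topspace X - no_common_torus_zero S0 S1)" using closed by simp
  moreover have "no_common_torus_zero S0 S1 \<subseteq> topspace X"
    by (auto simp: no_common_torus_zero_def X_def)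
  ultimately show ?thesis by (simp add: openin_closedin_eq X_def)
qed

text \<open>
  Changing a single coefficient \<open>c1 k\<close> by \<open>\<epsilon>\<close> moves the value of the second polynomial at each of
  the finitely many roots \<open>t\<close> of the first one by \<open>\<epsilon> t\<^sup>k\<close>. For \<open>t \<noteq> 0\<close> only one \<open>\<epsilon>\<close> makes
  it vanish there, so arbitrarily small \<open>\<epsilon>\<close> avoid all common zeros outside \<open>0\<close>.
\<close>

lemma dense_no_common_torus_zero:
  assumes S0: "finite S0" "S0 \<noteq> {}" and S1: "finite S1" "S1 \<noteq> {}"
  shows "coeff_space S0 S1 closure_of no_common_torus_zero S0 S1 = topspace (coeff_space S0 S1)"
proof (rule subset_antisym[OF closure_of_subset_topspace], rule subsetI)
  fix c assume c: "c \<in> topspace (coeff_space S0 S1)"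
  obtain c0 c1 where c_eq: "c = (c0, c1)" by fastforce
  obtain k where k: "k \<in> S1" using S1 by blast
  have c0: "c0 \<in> (\<Pi>\<^sub>E k\<in>S0. - {0})" and c1: "c1 \<in> (\<Pi>\<^sub>E k\<in>S1. - {0})"
    using c by (auto simp: c_eq topspace_coeff_space)
  define f where "f \<epsilon> = (c0, c1(k := c1 k + \<epsilon>))" for \<epsilon>
  define E where "E = {\<epsilon>. c1 k + \<epsilon> \<noteq> 0}"
  have "open E"
    unfolding E_def by (intro open_Collect_neq continuous_intros)
  have f_space: "f \<epsilon> \<in> topspace (coeff_space S0 S1)" if "\<epsilon> \<in> E" for \<epsilon>
    using c0 c1 k that by (auto simp: f_def E_def topspace_coeff_space PiE_iff extensional_def)
  have "continuous_map (top_of_set E) (coeff_space S0 S1) f"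
    unfolding coeff_space_def continuous_map_pairwise
      continuous_map_componentwise[where f = "snd \<circ> f"]
  proof (intro conjI ballI)
    show "continuous_map (top_of_set E) (product_topology (\<lambda>_. top_of_set (- {0})) S0) (fst \<circ> f)"
      using c0 by (simp add: f_def o_def)
    show "(snd \<circ> f) ` topspace (top_of_set E) \<subseteq> extensional S1"
      using c1 k by (auto simp: f_def extensional_def PiE_iff)
    fix l assume l: "l \<in> S1"
    have "continuous_on E (\<lambda>\<epsilon>. (snd \<circ> f) \<epsilon> l)"
      by (cases "l = k") (auto simp: f_def intro!: continuous_intros)
    moreover have "(snd \<circ> f) \<epsilon> l \<noteq> 0" if "\<epsilon> \<in> E" for \<epsilon>
      using f_space[OF that] l by (auto simp: topspace_coeff_space mem_Times_iff PiE_iff)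
    ultimately show "continuous_map (top_of_set E) (top_of_set (- {0})) (\<lambda>\<epsilon>. (snd \<circ> f) \<epsilon> l)"
      by (auto simp: continuous_map_in_subtopology)
  qed
  show "c \<in> coeff_space S0 S1 closure_of no_common_torus_zero S0 S1"
    unfolding in_closure_of
  proof (intro conjI c allI impI)
    fix T assume T: "c \<in> T \<and> openin (coeff_space S0 S1) T"
    define V where "V = {\<epsilon> \<in> E. f \<epsilon> \<in> T}"
    have "openin (top_of_set E) V"
      using openin_continuous_map_preimage[OF \<open>continuous_map (top_of_set E) _ f\<close>] T
      by (auto simp: V_def)
    then have "open V" using \<open>open E\<close> openin_open_trans by blast
    have "0 \<in> V" using T c1 k by (auto simp: V_def E_def f_def c_eq PiE_iff)
    then have "infinite V" using \<open>open V\<close> finite_imp_not_open by blast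
    \<comment> \<open>the values of \<open>\<epsilon>\<close> that create a common zero at some \<open>t \<noteq> 0\<close>\<close>
    define bad where "bad = (\<lambda>t. - poly (sparse_poly S1 c1) t / t ^ k) ` {t. poly (sparse_poly S0 c0) t = 0}"
    have "sparse_poly S0 c0 \<noteq> 0"
    proof -
      obtain l where "l \<in> S0" using S0 by blast
      then have "coeff (sparse_poly S0 c0) l \<noteq> 0" using c0 S0 by (auto simp: coeff_sparse_poly PiE_iff)
      then show ?thesis by auto
    qed
    then have "finite bad" unfolding bad_def using poly_roots_finite by blast
    then obtain \<epsilon> where \<epsilon>: "\<epsilon> \<in> V" "\<epsilon> \<notin> bad" using \<open>infinite V\<close> by (meson finite_subset subsetI)
    have "poly (sparse_poly S1 (c1(k := c1 k + \<epsilon>))) t = poly (sparse_poly S1 c1) t + \<epsilon> * t ^ k" for t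
    proof -
      have "poly (sparse_poly S1 (c1(k := c1 k + \<epsilon>))) t
          = (\<Sum>l\<in>S1. c1 l * t ^ l + (if l = k then \<epsilon> * t ^ k else 0))"
        unfolding poly_sparse_poly by (intro sum.cong) (auto simp: algebra_simps)
      then show ?thesis using S1 k by (simp add: sum.distrib poly_sparse_poly)
    qed
    moreover have "poly (sparse_poly S1 c1) t + \<epsilon> * t ^ k \<noteq> 0"
      if "t \<noteq> 0" "poly (sparse_poly S0 c0) t = 0" for t
    proof
      assume "poly (sparse_poly S1 c1) t + \<epsilon> * t ^ k = 0"
      then have "\<epsilon> = - poly (sparse_poly S1 c1) t / t ^ k"
        using that by (simp add: field_simps add_eq_0_iff)
      then show False using that \<epsilon> unfolding bad_def by blast
    qed
    ultimately have "f \<epsilon> \<in> no_common_torus_zero S0 S1"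
      using f_space[of \<epsilon>] \<epsilon> by (auto simp: no_common_torus_zero_def f_def V_def)
    then show "\<exists>y. y \<in> no_common_torus_zero S0 S1 \<and> y \<in> T"
      using \<epsilon> by (intro exI[of _ "f \<epsilon>"]) (auto simp: V_def)
  qed
qed

section \<open>The implicit polygon\<close>

text \<open>
  The enumeration starts with \<open>a 0 = 0\<close> because of the term \<open>x\<close> or \<open>y\<close>, so the lowest exponent of a
  polynomial without constant term is \<open>a 1\<close>.
\<close>

lemma sparse_poly_extremal_exponents:
  fixes a :: "nat \<Rightarrow> nat"
  assumes S: "finite S" and n: "1 \<le> n" and a: "strict_mono_on {0..n} a" "a ` {0..n} = insert 0 S"
    and c: "\<And>k. k \<in> S \<Longrightarrow> c k \<noteq> 0"
  shows "S \<noteq> {}" and "degree (sparse_poly S c) = a n" and "0 < a n"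
    and "0 \<notin> S \<Longrightarrow> order 0 (sparse_poly S c) = a 1"
proof -
  have less: "a i < a j" if "i < j" "j \<le> n" for i j
    using a(1) that by (auto simp: strict_mono_on_def)
  have mem: "a i \<in> S" if "0 < i" "i \<le> n" for i
  proof -
    have "a i \<noteq> 0" using less[of 0 i] that by simp
    moreover have "a i \<in> insert 0 S" unfolding a(2)[symmetric] using that by simp
    ultimately show ?thesis by simp
  qed
  show pos: "0 < a n" using less[of 0 n] n by simp
  show "S \<noteq> {}" using mem[of n] n by auto
  have idx: "\<exists>i\<le>n. k = a i" if "k \<in> S" for k
  proof -
    have "k \<in> a ` {0..n}" unfolding a(2) using that by simp
    then show ?thesis by auto
  qed
  show "degree (sparse_poly S c) = a n"
  proof (rule antisym)
    show "degree (sparse_poly S c) \<le> a n"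
    proof (rule degree_le, intro allI impI)
      fix k assume "a n < k"
      have "k \<notin> S"
      proof
        assume "k \<in> S"
        then obtain i where "i \<le> n" "k = a i" using idx by blast
        then show False using \<open>a n < k\<close> less[of i n] by (cases "i = n") auto
      qed
      then show "coeff (sparse_poly S c) k = 0" by (simp add: coeff_sparse_poly S)
    qed
    show "a n \<le> degree (sparse_poly S c)"
      by (rule le_degree) (use mem[of n] n c in \<open>simp add: coeff_sparse_poly S\<close>)
  qed
  assume "0 \<notin> S"
  show "order 0 (sparse_poly S c) = a 1"
  proof (rule order_0_eqI)
    show "coeff (sparse_poly S c) (a 1) \<noteq> 0" using mem[of 1] n c by (simp add: coeff_sparse_poly S)
    fix k assume k: "k < a 1"
    have "k \<notin> S"
    proof
      assume "k \<in> S"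
      then obtain i where i: "i \<le> n" "k = a i" using idx by blast
      have "\<not> 1 < i" using k less[of 1 i] i by force
      moreover have "i \<noteq> 1" using k i by auto
      ultimately have "i = 0" by simp
      moreover have "a 0 = 0"
      proof -
        have "0 \<in> a ` {0..n}" unfolding a(2) by simp
        then obtain l where "l \<le> n" "a l = 0" by auto
        then show ?thesis using less[of 0 l] by (cases "l = 0") auto
      qed
      ultimately show False using i \<open>k \<in> S\<close> \<open>0 \<notin> S\<close> by simp
    qed
    then show "coeff (sparse_poly S c) k = 0" by (simp add: coeff_sparse_poly S)
  qed
qed

theorem theorem20:
  fixes S0 S1 :: "nat set" and n m :: nat and a0 a1 :: "nat \<Rightarrow> nat"
  assumes "finite S0" and "finite S1"
    and "1 \<le> n" and "strict_mono_on {0..n} a0" and "a0 ` {0..n} = insert 0 S0"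
    and "1 \<le> m" and "strict_mono_on {0..m} a1" and "a1 ` {0..m} = insert 0 S1"
  shows "\<exists>U. openin (coeff_space S0 S1) U
           \<and> (coeff_space S0 S1) closure_of U = topspace (coeff_space S0 S1)
           \<and> (\<forall>c0 c1 P0 P1 \<phi>.
                (c0, c1) \<in> U \<longrightarrow> P0 = sparse_poly S0 c0 \<longrightarrow> P1 = sparse_poly S1 c1 \<longrightarrow>
                has_param_degree P0 P1 1 \<longrightarrow> implicit_equation P0 P1 \<phi> \<longrightarrow>
                (coeff P0 0 \<noteq> 0 \<or> coeff P1 0 \<noteq> 0 \<longrightarrow>
                   newton_polygon \<phi> =
                     convex hull {(0, 0), (real (a1 m), 0), (0, real (a0 n))}) \<and>
                (coeff P0 0 = 0 \<and> coeff P1 0 = 0 \<longrightarrow>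
                   newton_polygon \<phi> =
                     convex hull {(real (a1 1), 0), (real (a1 m), 0),
                                  (0, real (a0 n)), (0, real (a0 1))}))"
proof (intro exI[of _ "no_common_torus_zero S0 S1"] conjI allI impI)
  have ne: "S0 \<noteq> {}" "S1 \<noteq> {}"
    using sparse_poly_extremal_exponents(1)[of S0 n a0 "\<lambda>_. 1"]
      sparse_poly_extremal_exponents(1)[of S1 m a1 "\<lambda>_. 1"] assms by simp_all
  show "openin (coeff_space S0 S1) (no_common_torus_zero S0 S1)"
    using openin_no_common_torus_zero assms(1,2) ne by blast
  show "coeff_space S0 S1 closure_of no_common_torus_zero S0 S1 = topspace (coeff_space S0 S1)"
    using dense_no_common_torus_zero assms(1,2) ne by blast
  fix c0 c1 P0 P1 \<phi>
  assume U: "(c0, c1) \<in> no_common_torus_zero S0 S1"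
    and P0: "P0 = sparse_poly S0 c0" and P1: "P1 = sparse_poly S1 c1"
    and deg1: "has_param_degree P0 P1 1" and \<phi>: "implicit_equation P0 P1 \<phi>"
  have c: "k \<in> S0 \<Longrightarrow> c0 k \<noteq> 0" "k \<in> S1 \<Longrightarrow> c1 k \<noteq> 0" for k
    using U by (auto simp: no_common_torus_zero_def topspace_coeff_space PiE_iff)
  have no_common: "poly P0 t \<noteq> 0 \<or> poly P1 t \<noteq> 0" if "t \<noteq> 0" for t
    using U that by (auto simp: no_common_torus_zero_def P0 P1)
  have exps0: "degree P0 = a0 n" "0 < a0 n" "0 \<notin> S0 \<Longrightarrow> order 0 P0 = a0 1"
    using sparse_poly_extremal_exponents(2-)[OF assms(1,3,4,5), of c0] c by (simp_all add: P0)
  have exps1: "degree P1 = a1 m" "0 < a1 m" "0 \<notin> S1 \<Longrightarrow> order 0 P1 = a1 1"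
    using sparse_poly_extremal_exponents(2-)[OF assms(2,6,7,8), of c1] c by (simp_all add: P1)
  have deg: "degree P0 > 0" "degree P1 > 0" using exps0(1,2) exps1(1,2) by simp_all
  note polygon = newton_polygon_implicit_equation[OF deg deg1 \<phi>]
  show "newton_polygon \<phi> = convex hull {(0, 0), (real (a1 m), 0), (0, real (a0 n))}"
    if "coeff P0 0 \<noteq> 0 \<or> coeff P1 0 \<noteq> 0"
    unfolding exps0(1)[symmetric] exps1(1)[symmetric] by (rule polygon(1)) (fact no_common, fact that)
  show "newton_polygon \<phi> = convex hull {(real (a1 1), 0), (real (a1 m), 0),
      (0, real (a0 n)), (0, real (a0 1))}"
    if zero: "coeff P0 0 = 0 \<and> coeff P1 0 = 0"
  proof -
    have "0 \<notin> S0" "0 \<notin> S1"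
      using zero c assms(1,2) by (auto simp: P0 P1 coeff_sparse_poly split: if_splits)
    then have "order 0 P0 = a0 1" "order 0 P1 = a1 1" using exps0(3) exps1(3) by blast+
    moreover have "newton_polygon \<phi> = convex hull {(real (order 0 P1), 0), (real (degree P1), 0),
        (0, real (degree P0)), (0, real (order 0 P0))}"
      by (rule polygon(2)) (fact no_common, fact zero)
    ultimately show ?thesis by (simp only: exps0(1) exps1(1))
  qed
qed

end
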